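(* Let $H$ be a non-empty graph isomorphic to an induced subgraph of $Q_k$ for some $k$, and let $l = |H|$. Then there is a $(1 \bmod l)$-partition of $(P_{2l})^k$ into induced copies of $H$.
   Context: $Q_k$ is the $k$-dimensional hypercube on $\{0,1\}^k$; $P_m$ is the path on $m$ vertices; $|H|$ is the number of vertices of $H$. For graphs $G_1,G_2$ the Cartesian product $G_1\times G_2$ has vertex set $V(G_1)\times V(G_2)$, with $(u_1,u_2)\sim(v_1,v_2)$ iff either $u_1=v_1$ and $u_2v_2\in E(G_2)$, or $u_2=v_2$ and $u_1v_1\in E(G_1)$; $G^k$ is the product of $k$ copies of $G$. An induced copy of $H$ in $G$ is an induced subgraph of $G$ isomorphic to $H$. A $(1 \bmod l)$-partition of $G$ into induced copies of $H$ is a finite multiset (copies may be repeated) of induced copies of $H$ in $G$ such that every vertex of $G$ lies in a number of members of the multiset (counted with multiplicity) that is congruent to $1$ modulo $l$. *)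

theory Defs
  imports
    "HOL-Library.Multiset"
    "HOL-Number_Theory.Cong"
    "Graph_Theory.Graph_Theory"
begin

text \<open>
  A finite simple graph is a \<^term>\<open>G :: 'a pair_pre_digraph\<close> with \<^term>\<open>pair_graph G\<close>: a finite
  loopless digraph with symmetric arc set, an edge \<open>uv\<close> being represented by the two arcs
  \<open>(u, v)\<close> and \<open>(v, u)\<close>.
\<close>

definition path_graph :: "nat \<Rightarrow> nat pair_pre_digraph" where
  "path_graph m =
    \<lparr> pverts = {..<m},
      parcs = {(i, j). i < m \<and> j < m \<and> (j = Suc i \<or> i = Suc j)} \<rparr>"

definition hypercube :: "nat \<Rightarrow> nat list pair_pre_digraph" where
  "hypercube k =
    \<lparr> pverts = {xs. length xs = k \<and> set xs \<subseteq> {0, 1}},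
      parcs = {(xs, ys). length xs = k \<and> set xs \<subseteq> {0, 1} \<and> length ys = k \<and> set ys \<subseteq> {0, 1} \<and>
                         (\<exists>!i. i < k \<and> xs ! i \<noteq> ys ! i)} \<rparr>"

definition cart_prod :: "'a pair_pre_digraph \<Rightarrow> 'b pair_pre_digraph \<Rightarrow> ('a \<times> 'b) pair_pre_digraph" where
  "cart_prod G1 G2 =
    \<lparr> pverts = pverts G1 \<times> pverts G2,
      parcs = {((u1, u2), (v1, v2)).
                 u1 \<in> pverts G1 \<and> u2 \<in> pverts G2 \<and> v1 \<in> pverts G1 \<and> v2 \<in> pverts G2 \<and>
                 (u1 = v1 \<and> (u2, v2) \<in> parcs G2 \<or> u2 = v2 \<and> (u1, v1) \<in> parcs G1)} \<rparr>"

text \<open>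
  The iterated product, with the nested pairs \<open>(x\<^sub>1, (x\<^sub>2, \<dots>))\<close> relabelled as lists so that all
  powers of a graph live in one type. The empty product is the graph with one vertex.
\<close>

primrec graph_power :: "'a pair_pre_digraph \<Rightarrow> nat \<Rightarrow> 'a list pair_pre_digraph" where
  "graph_power G 0 = \<lparr> pverts = {[]}, parcs = {} \<rparr>"
| "graph_power G (Suc k) =
    \<lparr> pverts = (\<lambda>(x, xs). x # xs) ` pverts (cart_prod G (graph_power G k)),
      parcs = map_prod (\<lambda>(x, xs). x # xs) (\<lambda>(x, xs). x # xs) ` parcs (cart_prod G (graph_power G k)) \<rparr>"

definition induced_copy :: "'b pair_pre_digraph \<Rightarrow> 'a pair_pre_digraph \<Rightarrow> 'b pair_pre_digraph \<Rightarrow> bool" where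
  "induced_copy K H G \<longleftrightarrow>
    induced_subgraph (with_proj K) (with_proj G) \<and> digraph_iso (with_proj H) (with_proj K)"

definition one_mod_partition ::
  "nat \<Rightarrow> 'b pair_pre_digraph multiset \<Rightarrow> 'a pair_pre_digraph \<Rightarrow> 'b pair_pre_digraph \<Rightarrow> bool" where
  "one_mod_partition l \<K> H G \<longleftrightarrow>
    (\<forall>K \<in># \<K>. induced_copy K H G) \<and>
    (\<forall>v \<in> pverts G. [size {# K \<in># \<K>. v \<in> pverts K #} = 1] (mod l))"

lemma pverts_graph_power:
  "pverts (graph_power G k) = {xs. length xs = k \<and> set xs \<subseteq> pverts G}"
proof (induction k)
  case (Suc k)
  show ?case
    by (auto simp: cart_prod_def Suc image_iff length_Suc_conv)
qed auto

lemma parcs_graph_power: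
  assumes "pair_graph G"
  shows "parcs (graph_power G k) =
    {(xs, ys). length xs = k \<and> set xs \<subseteq> pverts G \<and> length ys = k \<and> set ys \<subseteq> pverts G \<and>
               (\<exists>i<k. (xs ! i, ys ! i) \<in> parcs G \<and> (\<forall>j<k. j \<noteq> i \<longrightarrow> xs ! j = ys ! j))}"
proof -
  interpret pair_graph G by fact
  define R where "R n xs ys \<longleftrightarrow>
      (\<exists>i<n. (xs ! i, ys ! i) \<in> parcs G \<and> (\<forall>j<n. j \<noteq> i \<longrightarrow> xs ! j = ys ! j))" for n xs ys
  have step: "R (Suc n) (u # us) (v # vs) \<longleftrightarrow> (u = v \<and> R n us vs \<or> us = vs \<and> (u, v) \<in> parcs G)"
    if "length us = n" "length vs = n" for n u v us vs
  proof -
    have "(\<forall>j<n. us ! j = vs ! j) \<longleftrightarrow> us = vs"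
      using that by (auto intro: nth_equalityI)
    then show ?thesis
      unfolding R_def Ex_less_Suc2 All_less_Suc2 by auto
  qed
  have mem: "(xs, ys) \<in> parcs (graph_power G (Suc n)) \<longleftrightarrow>
      (\<exists>u us v vs. xs = u # us \<and> ys = v # vs \<and> ((u, us), (v, vs)) \<in> parcs (cart_prod G (graph_power G n)))"
    for n xs ys
    by (force simp: image_iff)
  have "(xs, ys) \<in> parcs (graph_power G k) \<longleftrightarrow>
      length xs = k \<and> set xs \<subseteq> pverts G \<and> length ys = k \<and> set ys \<subseteq> pverts G \<and> R k xs ys" for xs ys
  proof (induction k arbitrary: xs ys)
    case 0
    show ?case by (simp add: R_def)
  next
    case (Suc k)
    show ?case
      unfolding mem
      by (cases xs; cases ys)
         (auto simp: cart_prod_def pverts_graph_power Suc.IH step)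
  qed
  then show ?thesis unfolding R_def by auto
qed

lemma pair_graph_path_graph: "pair_graph (path_graph m)"
proof
  show "finite (parcs (path_graph m))"
    by (rule finite_subset[of _ "{..<m} \<times> {..<m}"]) (auto simp: path_graph_def)
qed (auto simp: path_graph_def symmetric_def sym_def)

lemma hypercube_eq_power: "hypercube k = graph_power (path_graph 2) k"
proof -
  have V: "pverts (path_graph 2) = {0, 1}"
    by (auto simp: path_graph_def)
  have A: "(a, b) \<in> parcs (path_graph 2) \<longleftrightarrow> a \<in> {0, 1} \<and> b \<in> {0, 1} \<and> a \<noteq> b" for a b
    by (auto simp: path_graph_def)
  have "(\<exists>!i. i < k \<and> xs ! i \<noteq> ys ! i) \<longleftrightarrow>
      (\<exists>i<k. (xs ! i, ys ! i) \<in> parcs (path_graph 2) \<and> (\<forall>j<k. j \<noteq> i \<longrightarrow> xs ! j = ys ! j))"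
    if "length xs = k" "set xs \<subseteq> {0, 1}" "length ys = k" "set ys \<subseteq> {0, 1}" for xs ys
  proof -
    have "xs ! i \<in> {0, 1} \<and> ys ! i \<in> {0, 1}" if "i < k" for i
      using that \<open>length xs = k\<close> \<open>set xs \<subseteq> {0, 1}\<close> \<open>length ys = k\<close> \<open>set ys \<subseteq> {0, 1}\<close>
      by (metis nth_mem subsetD)
    then have "(xs ! i, ys ! i) \<in> parcs (path_graph 2) \<longleftrightarrow> xs ! i \<noteq> ys ! i" if "i < k" for i
      using that unfolding A by blast
    then have "(\<exists>i<k. (xs ! i, ys ! i) \<in> parcs (path_graph 2) \<and> (\<forall>j<k. j \<noteq> i \<longrightarrow> xs ! j = ys ! j)) \<longleftrightarrow>
        (\<exists>i<k. xs ! i \<noteq> ys ! i \<and> (\<forall>j<k. j \<noteq> i \<longrightarrow> xs ! j = ys ! j))"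
      by (simp cong: conj_cong)
    then show ?thesis unfolding Ex1_def by blast
  qed
  then have "(xs, ys) \<in> parcs (hypercube k) \<longleftrightarrow> (xs, ys) \<in> parcs (graph_power (path_graph 2) k)" for xs ys
    unfolding parcs_graph_power[OF pair_graph_path_graph] V hypercube_def by simp blast
  then have "parcs (hypercube k) = parcs (graph_power (path_graph 2) k)"
    by auto
  moreover have "pverts (hypercube k) = pverts (graph_power (path_graph 2) k)"
    unfolding pverts_graph_power V by (simp add: hypercube_def)
  ultimately show ?thesis by simp
qed

lemma pair_graph_graph_power:
  assumes "pair_graph G"
  shows "pair_graph (graph_power G k)"
proof -
  interpret pair_graph G by fact
  have fin: "finite (pverts (graph_power G k))"
    using finite_lists_length_eq[OF pair_finite_verts, of k]
    by (simp add: pverts_graph_power conj_commute)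
  show ?thesis
  proof
    show "finite (pverts (graph_power G k))" by (rule fin)
    show "finite (parcs (graph_power G k))"
      by (rule finite_subset[OF _ finite_cartesian_product[OF fin fin]])
         (auto simp: parcs_graph_power[OF assms] pverts_graph_power)
    show "symmetric (with_proj (graph_power G k))"
    proof (unfold symmetric_def with_proj_simps, rule symI)
      fix xs ys assume "(xs, ys) \<in> parcs (graph_power G k)"
      then have "length xs = k" "set xs \<subseteq> pverts G" "length ys = k" "set ys \<subseteq> pverts G"
        and "\<exists>i<k. (ys ! i, xs ! i) \<in> parcs G \<and> (\<forall>j<k. j \<noteq> i \<longrightarrow> ys ! j = xs ! j)"
        unfolding parcs_graph_power[OF assms] using arcs_symmetric by auto
      then show "(ys, xs) \<in> parcs (graph_power G k)"
        unfolding parcs_graph_power[OF assms] by blast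
    qed
    show "fst e \<noteq> snd e" if "e \<in> parcs (graph_power G k)" for e
    proof -
      from that obtain i where "(fst e ! i, snd e ! i) \<in> parcs G"
        by (auto simp: parcs_graph_power[OF assms])
      then show ?thesis using no_loops' by fastforce
    qed
  qed (auto simp: parcs_graph_power[OF assms] pverts_graph_power)
qed

text \<open>On simple graphs, the library isomorphism is the usual one.\<close>

lemma digraph_iso_pair_graph_iff:
  assumes "pair_graph H" "pair_graph K"
  shows "digraph_iso (with_proj H) (with_proj K) \<longleftrightarrow>
    (\<exists>f. bij_betw f (pverts H) (pverts K) \<and>
         (\<forall>u\<in>pverts H. \<forall>v\<in>pverts H. (u, v) \<in> parcs H \<longleftrightarrow> (f u, f v) \<in> parcs K))"
    (is "?L \<longleftrightarrow> (\<exists>f. ?P f)")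
proof
  interpret H: pair_graph H by fact
  interpret K: pair_graph K by fact
  show "\<exists>f. ?P f" if ?L
  proof -
    from that obtain h where h: "H.digraph_isomorphism h" and K: "with_proj K = app_iso h (with_proj H)"
      unfolding digraph_iso_def by blast
    have v: "pverts K = iso_verts h ` pverts H" and a: "parcs K = iso_arcs h ` parcs H"
      and t: "iso_tail h = fst" and hd: "iso_head h = snd"
      using K by (auto simp: with_proj_def app_iso_def)
    have inj: "inj_on (iso_verts h) (pverts H)"
      using h by (simp add: H.digraph_isomorphism_def)
    have arc: "iso_arcs h (u, w) = (iso_verts h u, iso_verts h w)" if "(u, w) \<in> parcs H" for u w
      using h that t hd by (auto simp: H.digraph_isomorphism_def prod_eq_iff)
    have "(u, w) \<in> parcs H" if "u \<in> pverts H" "w \<in> pverts H"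
      "(iso_verts h u, iso_verts h w) \<in> parcs K" for u w
    proof -
      obtain x y where xy: "(x, y) \<in> parcs H" "iso_arcs h (x, y) = (iso_verts h u, iso_verts h w)"
        using \<open>(iso_verts h u, iso_verts h w) \<in> parcs K\<close> a by auto
      then have "x = u" "y = w"
        using arc[OF xy(1)] inj_onD[OF inj] that H.wellformed' by auto
      then show ?thesis using xy by simp
    qed
    moreover have "(iso_verts h u, iso_verts h w) \<in> parcs K" if "(u, w) \<in> parcs H" for u w
      using arc[OF that] a that by (metis imageI)
    ultimately have "?P (iso_verts h)"
      using inj v by (auto simp: bij_betw_def)
    then show ?thesis by blast
  qed
  show ?L if "\<exists>f. ?P f"
  proof -
    from that obtain f where f: "?P f" ..
    let ?h = "\<lparr> iso_verts = f, iso_arcs = map_prod f f, iso_head = snd, iso_tail = fst \<rparr>"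
    have inj: "inj_on f (pverts H)" and img: "f ` pverts H = pverts K"
      using f by (auto simp: bij_betw_def)
    have "inj_on (map_prod f f) (parcs H)"
      using inj_onD[OF inj] H.wellformed' by (intro inj_onI) auto
    then have h: "H.digraph_isomorphism ?h"
      using inj H.wf_digraph_axioms by (simp add: H.digraph_isomorphism_def)
    have "(x, y) \<in> map_prod f f ` parcs H" if xy: "(x, y) \<in> parcs K" for x y
    proof -
      obtain u v where "x = f u" "y = f v" "u \<in> pverts H" "v \<in> pverts H"
        using K.wellformed'[OF xy] img by (metis imageE)
      then show ?thesis using f xy by force
    qed
    moreover have "(f u, f v) \<in> parcs K" if "(u, v) \<in> parcs H" for u v
      using f that H.wellformed'[OF that] by blast
    ultimately have "map_prod f f ` parcs H = parcs K"
      by auto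
    then have "with_proj K = app_iso ?h (with_proj H)"
      using img by (simp add: with_proj_def app_iso_def)
    then show ?thesis using h unfolding digraph_iso_def by blast
  qed
qed

end

theory Submission
  imports Defs "HOL-Library.FuncSet"
begin

text \<open>
  Let \<open>S\<close> be the vertex set of a copy of \<open>H\<close> in the cube, and fix \<open>c \<in> S\<close>. In one coordinate, place
  the edge \<open>{0, 1}\<close> on \<open>{a, a + 1}\<close> or on \<open>{a + 1, a + 2}\<close>, always sending the value other than \<open>c\<^sub>i\<close>
  to \<open>a + 1\<close>; the first placement gets weight \<open>-q(a)\<close> (taken as
  \<open>(l - 1) q(a)\<close>, since multiplicities are natural numbers) and the second \<open>q(a)\<close>, where
  \<open>q(a) = l - 1 - \<lfloor>a/2\<rfloor>\<close>. Modulo \<open>l\<close> the value other than \<open>c\<^sub>i\<close> then covers nothing, while \<open>c\<^sub>i\<close>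
  covers each \<open>v\<close> with weight \<open>q(v - 2) - q(v) = 1\<close>. Taking products over the coordinates, \<open>c\<close> covers
  every vertex of the grid once and every other vertex of \<open>S\<close> covers each vertex \<open>0\<close> times.
\<close>

section \<open>Placements in one coordinate and their weights\<close>

definition place :: "nat \<Rightarrow> nat \<times> bool \<Rightarrow> nat \<Rightarrow> nat" where
  "place c = (\<lambda>(a, t) x. if x \<noteq> c then a + 1 else if t then a + 2 else a)"

definition weight :: "nat \<Rightarrow> nat \<times> bool \<Rightarrow> nat" where
  "weight l = (\<lambda>(a, t). (l - 1 - a div 2) * (if t then 1 else l - 1))"

text \<open>The bound keeps \<open>a + 2\<close> on a path with \<open>2 * l\<close> vertices. The
  set is empty when \<open>l = 1\<close>, where congruences are trivial.\<close>

definition placements :: "nat \<Rightarrow> (nat \<times> bool) set" where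
  "placements l = {..<2 * l - 2} \<times> UNIV"

lemma finite_placements [simp]: "finite (placements l)"
  by (simp add: placements_def)

lemma place_less:
  assumes "p \<in> placements l"
  shows "place c p x < 2 * l"
  using assms by (auto simp: placements_def place_def)

lemma place_eq_iff:
  assumes "c \<in> {0, 1}" "x \<in> {0, 1}" "y \<in> {0, 1}"
  shows "place c p x = place c p y \<longleftrightarrow> x = y"
  using assms by (auto simp: place_def split: prod.splits)

text \<open>The value other than \<open>c\<close> goes to \<open>a + 1\<close> and \<open>c\<close>
  goes to one of its two neighbours, so distinct values land on adjacent vertices.\<close>

lemma place_adjacent_iff:
  assumes "p \<in> placements l" "c \<in> {0, 1}" "x \<in> {0, 1}" "y \<in> {0, 1}"
  shows "(place c p x, place c p y) \<in> parcs (path_graph (2 * l)) \<longleftrightarrow> (x, y) \<in> parcs (path_graph 2)"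
  using assms by (auto simp: place_def placements_def path_graph_def split: if_splits)

lemma sum_weight_cong:
  assumes "0 < l" "v < 2 * l"
  shows "[(\<Sum>p\<in>placements l. of_bool (place c p x = v) * weight l p) = of_bool (x = c)] (mod l)"
proof -
  let ?q = "\<lambda>a. l - 1 - a div 2"
  have split: "(\<Sum>p\<in>placements l. of_bool (place c p x = v) * weight l p) =
      (\<Sum>a<2 * l - 2. of_bool (place c (a, True) x = v) * ?q a
        + of_bool (place c (a, False) x = v) * (?q a * (l - 1)))"
    unfolding placements_def sum.cartesian_product' UNIV_bool
    by (simp add: weight_def add.commute del: sum_of_bool_mult_eq)
  show ?thesis
  proof (cases "x = c")
    case False
    \<comment> \<open>Both placements at \<open>a\<close> send \<open>x\<close> to
      \<open>a + 1\<close>; their weights add up to a multiple of \<open>l\<close>.\<close>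
    have "q + q * (l - 1) = q * l" for q
      using assms(1) by (metis One_nat_def Suc_pred mult_Suc_right)
    then have "(\<Sum>p\<in>placements l. of_bool (place c p x = v) * weight l p) =
        (\<Sum>a<2 * l - 2. of_bool (a + 1 = v) * ?q a) * l"
      unfolding split sum_distrib_right using False
      by (intro sum.cong) (auto simp: place_def)
    then show ?thesis
      using False by (simp add: cong_def)
  next
    case True
    \<comment> \<open>The factor \<open>of_bool (2 \<le> v)\<close> guards the truncated difference
      \<open>v - 2\<close>, and \<open>v < 2 * l\<close> puts \<open>v - 2\<close> in the range of
      summation.\<close>
    have "(\<Sum>a<2 * l - 2. of_bool (a + 2 = v) * ?q a) =
        (\<Sum>a<2 * l - 2. if a = v - 2 then of_bool (2 \<le> v) * ?q a else 0)"
      by (intro sum.cong) auto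
    also have "\<dots> = of_bool (2 \<le> v) * ?q (v - 2)"
      using assms by (auto simp: sum.delta)
    finally have 1: "(\<Sum>a<2 * l - 2. of_bool (a + 2 = v) * ?q a) = of_bool (2 \<le> v) * ?q (v - 2)" .
    have "(\<Sum>a<2 * l - 2. of_bool (a = v) * (?q a * (l - 1))) =
        (\<Sum>a<2 * l - 2. if a = v then ?q a * (l - 1) else 0)"
      by (intro sum.cong) auto
    \<comment> \<open>This also holds at the last two vertices, which lie outside the range of
      summation, because \<open>?q v = 0\<close> there.\<close>
    also have "\<dots> = ?q v * (l - 1)"
      using assms by (auto simp: sum.delta)
    finally have 2: "(\<Sum>a<2 * l - 2. of_bool (a = v) * (?q a * (l - 1))) = ?q v * (l - 1)" .
    have "(\<Sum>p\<in>placements l. of_bool (place c p x = v) * weight l p) =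
        of_bool (2 \<le> v) * ?q (v - 2) + ?q v * (l - 1)"
      unfolding split sum.distrib 1[symmetric] 2[symmetric] using True by (simp add: place_def)
    also have "[\<dots> = 1] (mod l)"
    proof (cases "2 \<le> v")
      case True
      then obtain u where v: "v = u + 2"
        using le_Suc_ex by (metis add.commute)
      \<comment> \<open>No truncation occurs: \<open>v < 2 * l\<close> gives
        \<open>v div 2 \<le> l - 1\<close>.\<close>
      have "?q u = ?q v + 1"
        using assms v by simp
      moreover have "?q v + ?q v * (l - 1) = ?q v * l"
        using assms(1) by (metis One_nat_def Suc_pred mult_Suc_right)
      ultimately have "of_bool (2 \<le> v) * ?q (v - 2) + ?q v * (l - 1) = 1 + ?q v * l"
        using v by (simp only: add_diff_cancel_right' le_add2 of_bool_eq(2) mult_1 ac_simps)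
      then show ?thesis by (simp only: cong_def mod_mult_self1)
    next
      case False
      \<comment> \<open>At the vertices 0 and 1 only the first placement contributes, with
        \<open>?q v = l - 1\<close>, so the total is the square of -1 modulo
        \<open>l\<close>.\<close>
      then have "of_bool (2 \<le> v) * ?q (v - 2) + ?q v * (l - 1) = (l - 1) * (l - 1)"
        by simp
      also have "[(l - 1) * (l - 1) = 1] (mod l)"
      proof -
        obtain m where "l = Suc m"
          using assms(1) gr0_implies_Suc by blast
        \<comment> \<open>Over the integers \<open>l - 2\<close> stays correct at
          \<open>l = 1\<close>.\<close>
        then have "int ((l - 1) * (l - 1)) = 1 + (int l - 2) * int l"
          by (simp add: algebra_simps)
        then show ?thesis
          unfolding cong_int_iff[symmetric] by (simp only: cong_def mod_mult_self1 of_nat_1)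
      qed
      finally show ?thesis .
    qed
    finally show ?thesis using True by simp
  qed
qed

section \<open>Coordinatewise embedding of the cube into the grid\<close>

definition place_list :: "nat list \<Rightarrow> (nat \<Rightarrow> nat \<times> bool) \<Rightarrow> nat list \<Rightarrow> nat list" where
  "place_list c f xs = map (\<lambda>i. place (c ! i) (f i) (xs ! i)) [0..<length xs]"

lemma length_place_list [simp]: "length (place_list c f xs) = length xs"
  and nth_place_list [simp]: "i < length xs \<Longrightarrow> place_list c f xs ! i = place (c ! i) (f i) (xs ! i)"
  by (simp_all add: place_list_def)

lemma pverts_hypercube: "pverts (hypercube k) = {xs. length xs = k \<and> (\<forall>i<k. xs ! i \<in> {0, 1})}"
  by (auto simp: hypercube_def subset_code(1) all_set_conv_all_nth)

lemma nth_hypercube: "xs \<in> pverts (hypercube k) \<Longrightarrow> i < k \<Longrightarrow> xs ! i \<in> {0, 1}"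
  by (simp add: pverts_hypercube)

lemma pverts_path_power:
  "pverts (graph_power (path_graph m) k) = {xs. length xs = k \<and> (\<forall>i<k. xs ! i < m)}"
  by (auto simp: pverts_graph_power path_graph_def subset_code(1) all_set_conv_all_nth)

lemma parcs_power_iff:
  assumes "pair_graph G" "xs \<in> pverts (graph_power G k)" "ys \<in> pverts (graph_power G k)"
  shows "(xs, ys) \<in> parcs (graph_power G k) \<longleftrightarrow>
    (\<exists>i<k. (xs ! i, ys ! i) \<in> parcs G \<and> (\<forall>j<k. j \<noteq> i \<longrightarrow> xs ! j = ys ! j))"
  using assms(2,3) unfolding parcs_graph_power[OF assms(1)] pverts_graph_power by simp

context
  fixes c :: "nat list" and f :: "nat \<Rightarrow> nat \<times> bool" and k l :: nat
  assumes c: "c \<in> pverts (hypercube k)"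
    and f: "f \<in> {..<k} \<rightarrow> placements l"
begin

lemma place_list_in_power:
  assumes "xs \<in> pverts (hypercube k)"
  shows "place_list c f xs \<in> pverts (graph_power (path_graph (2 * l)) k)"
  using assms f place_less by (auto simp: pverts_path_power pverts_hypercube Pi_iff)

lemma inj_on_place_list: "inj_on (place_list c f) (pverts (hypercube k))"
proof (intro inj_onI nth_equalityI)
  fix xs ys i
  assume xs: "xs \<in> pverts (hypercube k)" and ys: "ys \<in> pverts (hypercube k)"
    and eq: "place_list c f xs = place_list c f ys"
  then show "length xs = length ys"
    by (simp add: pverts_hypercube)
  assume "i < length xs"
  with eq \<open>length xs = length ys\<close> have "place (c ! i) (f i) (xs ! i) = place (c ! i) (f i) (ys ! i)"
    by (metis nth_place_list)
  then show "xs ! i = ys ! i"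
    using place_eq_iff[OF nth_hypercube[OF c] nth_hypercube[OF xs] nth_hypercube[OF ys], of i i i]
      xs \<open>i < length xs\<close> by (simp add: pverts_hypercube)
qed

text \<open>The cube is itself a power of \<open>path_graph 2\<close>, so adjacency on both sides
  asks for one adjacent coordinate and equality elsewhere; \<open>place\<close> preserves and
  reflects both conditions.\<close>

lemma place_list_adjacent_iff:
  assumes xs: "xs \<in> pverts (hypercube k)" and ys: "ys \<in> pverts (hypercube k)"
  shows "(place_list c f xs, place_list c f ys) \<in> parcs (graph_power (path_graph (2 * l)) k) \<longleftrightarrow>
    (xs, ys) \<in> parcs (hypercube k)"
proof -
  have len: "length xs = k" "length ys = k"
    using xs ys by (auto simp: pverts_hypercube)
  note mem = nth_hypercube[OF c] nth_hypercube[OF xs] nth_hypercube[OF ys]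
  have adj: "(place (c ! i) (f i) (xs ! i), place (c ! i) (f i) (ys ! i)) \<in> parcs (path_graph (2 * l))
      \<longleftrightarrow> (xs ! i, ys ! i) \<in> parcs (path_graph 2)"
    and eq: "place (c ! i) (f i) (xs ! i) = place (c ! i) (f i) (ys ! i) \<longleftrightarrow> xs ! i = ys ! i" if "i < k" for i
    using that by (intro place_adjacent_iff place_eq_iff mem funcset_mem[OF f]; simp)+
  show ?thesis
    unfolding parcs_power_iff[OF pair_graph_path_graph place_list_in_power[OF xs] place_list_in_power[OF ys]]
      hypercube_eq_power
      parcs_power_iff[OF pair_graph_path_graph xs[unfolded hypercube_eq_power] ys[unfolded hypercube_eq_power]]
    using adj eq by (simp add: len cong: conj_cong)
qed

end

section \<open>Induced subgraphs and transport of copies\<close>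

definition induced :: "'a pair_pre_digraph \<Rightarrow> 'a set \<Rightarrow> 'a pair_pre_digraph" where
  "induced G S = \<lparr> pverts = S, parcs = {e \<in> parcs G. fst e \<in> S \<and> snd e \<in> S} \<rparr>"

lemma pair_graph_induced:
  assumes "pair_graph G" "S \<subseteq> pverts G"
  shows "pair_graph (induced G S)"
proof -
  interpret pair_graph G by fact
  show ?thesis
  proof
    show "symmetric (with_proj (induced G S))"
      using arcs_symmetric by (auto simp: induced_def symmetric_def sym_def)
  qed (use assms(2) pair_finite_verts pair_finite_arcs pair_no_loops in
        \<open>auto simp: induced_def intro: finite_subset\<close>)
qed

lemma induced_subgraph_induced:
  assumes "pair_graph G" "S \<subseteq> pverts G"
  shows "induced_subgraph (with_proj (induced G S)) (with_proj G)"
proof -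
  have "pair_wf_digraph G" "pair_wf_digraph (induced G S)"
    using assms pair_graph_induced[OF assms]
    by (simp_all add: pair_graph_def pair_digraph_def pair_fin_digraph_def)
  then show ?thesis
    using assms(2)
    by (auto simp: induced_subgraph_def subgraph_def compatible_def wf_digraph_wp_iff induced_def)
qed

lemma induced_copyD:
  assumes "induced_copy K H G"
  shows "pverts K \<subseteq> pverts G" "K = induced G (pverts K)"
  using assms by (auto simp: induced_copy_def induced_subgraph_def subgraph_def induced_def
      intro!: pair_pre_digraph.equality)

text \<open>An isomorphism from \<open>H\<close> to \<open>K\<close> composed with \<open>g\<close>
  is one onto the image: \<open>K\<close> and the image each carry all arcs of their host graph, and
  \<open>g\<close> matches these arcs.\<close>

lemma induced_copy_image:
  assumes H: "pair_graph H" and G: "pair_graph G" and G': "pair_graph G'" and K: "induced_copy K H G"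
    and sub: "g ` pverts K \<subseteq> pverts G'" and inj: "inj_on g (pverts K)"
    and adj: "\<And>u v. u \<in> pverts K \<Longrightarrow> v \<in> pverts K \<Longrightarrow> (g u, g v) \<in> parcs G' \<longleftrightarrow> (u, v) \<in> parcs G"
  shows "induced_copy (induced G' (g ` pverts K)) H G'"
proof -
  have Keq: "K = induced G (pverts K)" and Ksub: "pverts K \<subseteq> pverts G"
    using induced_copyD[OF K] by blast+
  have pgK: "pair_graph K"
    by (subst Keq) (rule pair_graph_induced[OF G Ksub])
  have arcK: "(u, v) \<in> parcs K \<longleftrightarrow> (u, v) \<in> parcs G" if "u \<in> pverts K" "v \<in> pverts K" for u v
    using that by (subst Keq) (simp add: induced_def)
  obtain h where h: "bij_betw h (pverts H) (pverts K)"
    "\<And>u v. u \<in> pverts H \<Longrightarrow> v \<in> pverts H \<Longrightarrow> (u, v) \<in> parcs H \<longleftrightarrow> (h u, h v) \<in> parcs K"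
    using K digraph_iso_pair_graph_iff[OF H pgK] unfolding induced_copy_def by blast
  have hK: "h u \<in> pverts K" if "u \<in> pverts H" for u
    using h(1) that by (rule bij_betwE[rule_format])
  have "bij_betw (g \<circ> h) (pverts H) (g ` pverts K)"
    using h(1) inj by (blast intro: bij_betw_trans inj_on_imp_bij_betw)
  moreover have "(u, v) \<in> parcs H \<longleftrightarrow> ((g \<circ> h) u, (g \<circ> h) v) \<in> parcs (induced G' (g ` pverts K))"
    if "u \<in> pverts H" "v \<in> pverts H" for u v
    using that hK by (simp add: h(2) arcK adj induced_def)
  ultimately have "digraph_iso (with_proj H) (with_proj (induced G' (g ` pverts K)))"
    unfolding digraph_iso_pair_graph_iff[OF H pair_graph_induced[OF G' sub]]
    by (intro exI[of _ "g \<circ> h"]) (simp add: induced_def)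
  then show ?thesis
    using induced_subgraph_induced[OF G' sub] by (simp add: induced_copy_def)
qed

section \<open>Weighted counting over all placements\<close>

lemma size_filter_sum_replicate_mset:
  assumes "finite A"
  shows "size (filter_mset P (\<Sum>x\<in>A. replicate_mset (w x) (g x))) = (\<Sum>x\<in>A. of_bool (P (g x)) * w x)"
proof -
  have *: "size (filter_mset P (replicate_mset n y)) = of_bool (P y) * n" for n y
    by (induction n) auto
  show ?thesis
    using assms by (induction rule: finite_induct) (simp_all add: * del: sum_of_bool_mult_eq)
qed

lemma of_bool_prod:
  assumes "finite A"
  shows "of_bool (\<forall>x\<in>A. P x) = (\<Prod>x\<in>A. of_bool (P x) :: 'a::comm_semiring_1)"
  using assms by (induction A rule: finite_induct) (simp_all add: of_bool_conj)

text \<open>The indicator of \<open>place_list c f xs = v\<close> and the weight both factor over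
  the coordinates, so the sum over all \<open>f\<close> is a product of one-coordinate sums, each
  known modulo \<open>l\<close>.\<close>

lemma sum_weight_place_list_cong:
  assumes "0 < l" "length c = k" "length xs = k"
    and v: "v \<in> pverts (graph_power (path_graph (2 * l)) k)"
  shows "[(\<Sum>f\<in>{..<k} \<rightarrow>\<^sub>E placements l. of_bool (place_list c f xs = v) * (\<Prod>i<k. weight l (f i)))
    = of_bool (xs = c)] (mod l)"
proof -
  have v: "length v = k" "\<And>i. i < k \<Longrightarrow> v ! i < 2 * l"
    using v by (auto simp: pverts_path_power)
  have "place_list c f xs = v \<longleftrightarrow> (\<forall>i\<in>{..<k}. place (c ! i) (f i) (xs ! i) = v ! i)" for f
    using assms(3) v(1) by (auto simp: list_eq_iff_nth_eq)
  then have "(\<Sum>f\<in>{..<k} \<rightarrow>\<^sub>E placements l. of_bool (place_list c f xs = v) * (\<Prod>i<k. weight l (f i))) =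
      (\<Sum>f\<in>{..<k} \<rightarrow>\<^sub>E placements l. \<Prod>i<k. of_bool (place (c ! i) (f i) (xs ! i) = v ! i) * weight l (f i))"
    by (simp only: of_bool_prod[OF finite_lessThan] prod.distrib)
  also have "\<dots> = (\<Prod>i<k. \<Sum>p\<in>placements l. of_bool (place (c ! i) p (xs ! i) = v ! i) * weight l p)"
    by (rule prod_sum_PiE[symmetric]) auto
  also have "[\<dots> = (\<Prod>i<k. of_bool (xs ! i = c ! i))] (mod l)"
    using v(2) by (intro cong_prod sum_weight_cong[OF assms(1)]) auto
  also have "(\<Prod>i<k. of_bool (xs ! i = c ! i)) = (of_bool (xs = c) :: nat)"
    using assms(2,3) by (auto simp: of_bool_prod[OF finite_lessThan, symmetric] list_eq_iff_nth_eq)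
  finally show ?thesis .
qed

section \<open>Assembling the partition\<close>

theorem theorem7:
  fixes H :: "'a pair_pre_digraph" and k l :: nat
  assumes "pair_graph H"
    and "pverts H \<noteq> {}"
    and "\<exists>K. induced_copy K H (hypercube k)"
    and "l = card (pverts H)"
  shows "\<exists>\<K>. one_mod_partition l \<K> H (graph_power (path_graph (2 * l)) k)"
proof -
  interpret H: pair_graph H by fact
  let ?G = "graph_power (path_graph (2 * l)) k"
  have G: "pair_graph ?G" and Q: "pair_graph (hypercube k)"
    by (simp_all add: hypercube_eq_power pair_graph_graph_power pair_graph_path_graph)
  have l: "0 < l"
    using assms(2,4) H.pair_finite_verts by (simp add: card_gt_0_iff)
  obtain K where K: "induced_copy K H (hypercube k)"
    using assms(3) ..
  define S where "S = pverts K"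
  have S: "S \<subseteq> pverts (hypercube k)"
    using induced_copyD(1)[OF K] by (simp add: S_def)
  then have finS: "finite S"
    using pair_fin_digraph.pair_finite_verts Q
    by (meson finite_subset pair_digraph_def pair_graph_def)
  \<comment> \<open>The isomorphism with \<open>H\<close> serves to show that \<open>S\<close> is
    nonempty, which supplies the base point \<open>c\<close>.\<close>
  have "pair_graph K"
    by (subst induced_copyD(2)[OF K]) (rule pair_graph_induced[OF Q induced_copyD(1)[OF K]])
  then obtain h where "bij_betw h (pverts H) S"
    using K digraph_iso_pair_graph_iff[OF assms(1)] unfolding induced_copy_def S_def by blast
  then obtain c where c: "c \<in> S"
    using assms(2) by (auto simp: bij_betw_def)
  have lenS: "length xs = k" if "xs \<in> S" for xs
    using that S by (auto simp: pverts_hypercube)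
  \<comment> \<open>Extensional functions are fixed outside \<open>{..<k}\<close>, so each choice of
    placements occurs exactly once in the sum.\<close>
  define F where "F = ({..<k} \<rightarrow>\<^sub>E placements l)"
  have finF: "finite F"
    by (simp add: F_def finite_PiE)
  have F: "f \<in> {..<k} \<rightarrow> placements l" if "f \<in> F" for f
    using that by (auto simp: F_def)
  have cQ: "c \<in> pverts (hypercube k)"
    using c S by blast
  define w where "w f = (\<Prod>i<k. weight l (f i))" for f
  define copy where "copy f = induced ?G (place_list c f ` S)" for f
  define \<K> where "\<K> = (\<Sum>f\<in>F. replicate_mset (w f) (copy f))"
  have copy: "induced_copy (copy f) H ?G" if "f \<in> F" for f
    unfolding copy_def S_def
  proof (rule induced_copy_image[OF assms(1) Q G K])
    note fF = F[OF that]
    show "place_list c f ` pverts K \<subseteq> pverts ?G"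
      using place_list_in_power[OF cQ fF] S by (auto simp: S_def)
    show "inj_on (place_list c f) (pverts K)"
      using inj_on_subset[OF inj_on_place_list[OF cQ fF] S] by (simp add: S_def)
    show "(place_list c f u, place_list c f v) \<in> parcs ?G \<longleftrightarrow> (u, v) \<in> parcs (hypercube k)"
      if "u \<in> pverts K" "v \<in> pverts K" for u v
      using place_list_adjacent_iff[OF cQ fF] S that unfolding S_def by blast
  qed
  have "[size {# L \<in># \<K>. v \<in> pverts L #} = 1] (mod l)" if v: "v \<in> pverts ?G" for v
  proof -
    \<comment> \<open>By injectivity at most one vertex of \<open>S\<close> lands on
      \<open>v\<close>, so membership becomes a sum over \<open>S\<close>.\<close>
    have hit: "(of_bool (v \<in> pverts (copy f)) :: nat) = (\<Sum>xs\<in>S. of_bool (place_list c f xs = v))"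
      if "f \<in> F" for f
    proof -
      have "inj_on (place_list c f) S"
        using inj_on_subset[OF inj_on_place_list[OF cQ F[OF that]] S] .
      then have "(\<Sum>xs\<in>S. of_bool (place_list c f xs = v)) = (\<Sum>y\<in>place_list c f ` S. of_bool (y = v) :: nat)"
        by (simp add: sum.reindex)
      also have "\<dots> = of_bool (v \<in> pverts (copy f))"
        using finS by (simp add: copy_def induced_def of_bool_def sum.delta)
      finally show ?thesis by simp
    qed
    have "size {# L \<in># \<K>. v \<in> pverts L #} = (\<Sum>f\<in>F. of_bool (v \<in> pverts (copy f)) * w f)"
      unfolding \<K>_def by (rule size_filter_sum_replicate_mset[OF finF])
    also have "\<dots> = (\<Sum>f\<in>F. \<Sum>xs\<in>S. of_bool (place_list c f xs = v) * w f)"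
      by (intro sum.cong refl) (simp only: hit sum_distrib_right)
    \<comment> \<open>With \<open>xs\<close> fixed first, the inner sum is the total weight with
      which \<open>xs\<close> covers \<open>v\<close>; modulo \<open>l\<close> only
      \<open>xs = c\<close> survives.\<close>
    also have "\<dots> = (\<Sum>xs\<in>S. \<Sum>f\<in>F. of_bool (place_list c f xs = v) * w f)"
      by (rule sum.swap)
    also have "[\<dots> = (\<Sum>xs\<in>S. of_bool (xs = c))] (mod l)"
      unfolding F_def w_def
      by (intro cong_sum sum_weight_place_list_cong l lenS c v)
    also have "(\<Sum>xs\<in>S. of_bool (xs = c)) = (1 :: nat)"
      using finS c by (simp add: of_bool_def sum.delta)
    finally show ?thesis .
  qed
  moreover have "induced_copy L H ?G" if "L \<in># \<K>" for L
    using that copy finF by (auto simp: \<K>_def set_mset_sum split: if_splits)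
  ultimately show ?thesis
    unfolding one_mod_partition_def by blast
qed

end
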